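(* Let $A_1=\{231,312,4321,21543\}$. For every positive integer $n$ and every integer $k\ge 3$, the number of permutations in $\operatorname{Av}_n(A_1)$ with exactly $k$ inversions is $$\binom{n-k}{k}+\sum_{\ell=k-3}^{n-3}\binom{\ell-(k-3)}{k-3}=\binom{n-k}{k}+\binom{n-k+1}{k-2}.$$
   Context: $\operatorname{Av}_n(S)$ is the set of permutations of length $n$ avoiding every pattern in $S$ (classical pattern avoidance). An inversion of a permutation $\pi$ is a pair of positions $i<j$ with $\pi_i>\pi_j$. Binomial coefficients $\binom{a}{b}$ with integer arguments are taken to be $0$ unless $0\le b\le a$; empty sums are $0$. *)

theory Defs
  imports Complex_Main "HOL-Library.Sublist" "HOL-Combinatorics.Multiset_Permutations"
begin

text \<open>
  A permutation of length \<open>n\<close> is represented by its one-line notation, i.e. by a list in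
  \<^term>\<open>permutations_of_set {1..n::nat}\<close>. List positions count from 0.
\<close>

definition order_isomorphic :: "nat list \<Rightarrow> nat list \<Rightarrow> bool" where
  "order_isomorphic xs ys \<longleftrightarrow>
     length xs = length ys \<and>
     (\<forall>i<length xs. \<forall>j<length xs. xs ! i < xs ! j \<longleftrightarrow> ys ! i < ys ! j)"

text \<open>
  \<^const>\<open>subseq\<close> is the relation of being a (not necessarily contiguous) subsequence.
\<close>

definition contains_pattern :: "nat list \<Rightarrow> nat list \<Rightarrow> bool" where
  "contains_pattern \<pi> \<sigma> \<longleftrightarrow> (\<exists>xs. subseq xs \<pi> \<and> order_isomorphic xs \<sigma>)"

definition Av :: "nat \<Rightarrow> nat list set \<Rightarrow> nat list set" where
  "Av n S = {\<pi> \<in> permutations_of_set {1..n}. \<forall>\<sigma>\<in>S. \<not> contains_pattern \<pi> \<sigma>}"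

definition inversions :: "nat list \<Rightarrow> (nat \<times> nat) set" where
  "inversions \<pi> = {(i, j). i < j \<and> j < length \<pi> \<and> \<pi> ! i > \<pi> ! j}"

definition A1 :: "nat list set" where
  "A1 = {[2,3,1], [3,1,2], [4,3,2,1], [2,1,5,4,3]}"

text \<open>
  Binomial coefficients with integer arguments, zero outside \<open>0 \<le> b \<le> a\<close>. This differs from
  \<^const>\<open>gbinomial\<close>, which is nonzero for negative upper arguments.
\<close>

definition ibinom :: "int \<Rightarrow> int \<Rightarrow> nat" where
  "ibinom a b = (if 0 \<le> b \<and> b \<le> a then nat a choose nat b else 0)"

end

theory Submission
  imports Defs
begin

text \<open>
  Avoiding 231 and 312 forces a permutation to be layered, i.e. a direct sum of decreasing blocks,
  so it is encoded by the composition of its block lengths. Avoiding 4321 bounds the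
  blocks by 3, and avoiding 21543 says that a block of length 3 is preceded only by blocks of
  length 1. Counting such compositions by their first part gives Pascal-type recurrences.
\<close>

section \<open>Pattern containment in direct sums\<close>

lemma order_isomorphic_231:
  "order_isomorphic xs [2,3,1] \<longleftrightarrow> (\<exists>p q r. xs = [p,q,r] \<and> r < p \<and> p < q)"
  by (auto simp: order_isomorphic_def length_Suc_conv All_less_Suc numeral_eq_Suc)
     (auto simp: less_Suc_eq)

lemma order_isomorphic_312:
  "order_isomorphic xs [3,1,2] \<longleftrightarrow> (\<exists>p q r. xs = [p,q,r] \<and> q < r \<and> r < p)"
  by (auto simp: order_isomorphic_def length_Suc_conv All_less_Suc numeral_eq_Suc)
     (auto simp: less_Suc_eq)

text \<open>Although 321 does not belong to \<open>A1\<close>, it is the order type of 543 and hence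
  what remains of 21543 once 21 has been placed in an earlier layer.\<close>

lemma order_isomorphic_321:
  "order_isomorphic xs [3,2,1] \<longleftrightarrow> (\<exists>p q r. xs = [p,q,r] \<and> r < q \<and> q < p)"
  by (auto simp: order_isomorphic_def length_Suc_conv All_less_Suc numeral_eq_Suc)
     (auto simp: less_Suc_eq)

lemma order_isomorphic_4321:
  "order_isomorphic xs [4,3,2,1] \<longleftrightarrow> (\<exists>p q r s. xs = [p,q,r,s] \<and> s < r \<and> r < q \<and> q < p)"
  by (auto simp: order_isomorphic_def length_Suc_conv All_less_Suc numeral_eq_Suc)
     (auto simp: less_Suc_eq)

lemma order_isomorphic_21543:
  "order_isomorphic xs [2,1,5,4,3] \<longleftrightarrow>
     (\<exists>p q r s t. xs = [p,q,r,s,t] \<and> q < p \<and> p < t \<and> t < s \<and> s < r)"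
  by (auto simp: order_isomorphic_def length_Suc_conv All_less_Suc numeral_eq_Suc)
     (auto simp: less_Suc_eq)

lemma contains_pattern_231:
  "contains_pattern xs [2,3,1] \<longleftrightarrow> (\<exists>p q r. subseq [p,q,r] xs \<and> r < p \<and> p < q)"
  unfolding contains_pattern_def order_isomorphic_231 by blast

lemma contains_pattern_312:
  "contains_pattern xs [3,1,2] \<longleftrightarrow> (\<exists>p q r. subseq [p,q,r] xs \<and> q < r \<and> r < p)"
  unfolding contains_pattern_def order_isomorphic_312 by blast

lemma contains_pattern_321:
  "contains_pattern xs [3,2,1] \<longleftrightarrow> (\<exists>p q r. subseq [p,q,r] xs \<and> r < q \<and> q < p)"
  unfolding contains_pattern_def order_isomorphic_321 by blast

lemma contains_pattern_21543:
  "contains_pattern xs [2,1,5,4,3] \<longleftrightarrow>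
     (\<exists>p q r s t. subseq [p,q,r,s,t] xs \<and> q < p \<and> p < t \<and> t < s \<and> s < r)"
  unfolding contains_pattern_def order_isomorphic_21543 by blast

lemma contains_pattern_mono:
  "contains_pattern xs \<sigma> \<Longrightarrow> subseq xs ys \<Longrightarrow> contains_pattern ys \<sigma>"
  unfolding contains_pattern_def using subseq_order.trans by blast

text \<open>Otherwise the entries 1 of pattern literals are rewritten to \<open>Suc 0\<close>, and facts about the patterns no longer match.\<close>
declare One_nat_def [simp del]

lemma subseq_set_subset: "subseq xs ys \<Longrightarrow> set xs \<subseteq> set ys"
  by (induction rule: list_emb.induct) auto

text \<open>An occurrence meeting both parts starts in \<open>xs\<close> and ends in
  \<open>ys\<close>, so its first entry is below its last, against
  \<open>last \<sigma> < hd \<sigma>\<close>. This covers 231, 312, 321 and 4321, but not 21543,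
  whose first entry 2 is below its last entry 3.\<close>

lemma contains_pattern_append_indecomposable:
  assumes below: "\<And>x y. x \<in> set xs \<Longrightarrow> y \<in> set ys \<Longrightarrow> x < y"
    and \<sigma>: "\<sigma> \<noteq> []" "last \<sigma> < hd \<sigma>"
  shows "contains_pattern (xs @ ys) \<sigma> \<longleftrightarrow> contains_pattern xs \<sigma> \<or> contains_pattern ys \<sigma>"
proof
  assume "contains_pattern (xs @ ys) \<sigma>"
  then obtain zs where zs: "subseq zs (xs @ ys)" "order_isomorphic zs \<sigma>"
    by (auto simp: contains_pattern_def)
  then obtain us vs where uv: "zs = us @ vs" "subseq us xs" "subseq vs ys"
    by (auto simp: subseq_append_iff)
  have "us = [] \<or> vs = []"
  proof (rule ccontr)
    assume ne: "\<not> (us = [] \<or> vs = [])"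
    have "zs \<noteq> []" and len: "length zs = length \<sigma>"
      using zs(2) \<sigma> by (auto simp: order_isomorphic_def)
    then have "last zs < hd zs"
      using zs(2) \<sigma> by (simp add: order_isomorphic_def last_conv_nth hd_conv_nth)
    moreover have "hd zs \<in> set xs" "last zs \<in> set ys"
      using uv ne by (auto dest!: subseq_set_subset)
    ultimately show False
      using below by fastforce
  qed
  then show "contains_pattern xs \<sigma> \<or> contains_pattern ys \<sigma>"
    using uv zs(2) by (auto simp: contains_pattern_def)
next
  assume "contains_pattern xs \<sigma> \<or> contains_pattern ys \<sigma>"
  then show "contains_pattern (xs @ ys) \<sigma>"
    by (auto intro: contains_pattern_mono subseq_drop_many subseq_rev_drop_many)
qed

lemma sorted_wrt_subseq:
  assumes "subseq xs ys" "sorted_wrt P ys"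
  shows "sorted_wrt P xs"
  using assms by (induction rule: list_emb.induct) (auto dest!: subseq_set_subset)

lemma distinct_subseq: "subseq xs ys \<Longrightarrow> distinct ys \<Longrightarrow> distinct xs"
  by (induction rule: list_emb.induct) (auto dest!: subseq_set_subset)

lemma contains_pattern_decreasing:
  assumes "sorted_wrt (>) xs"
  shows "\<not> contains_pattern xs [2,3,1]" "\<not> contains_pattern xs [3,1,2]"
    "contains_pattern xs [3,2,1] \<longleftrightarrow> 3 \<le> length xs"
    "contains_pattern xs [4,3,2,1] \<longleftrightarrow> 4 \<le> length xs"
proof -
  have "r < q \<and> q < p" if "subseq [p,q,r] xs" for p q r
    using sorted_wrt_subseq[OF that assms] by simp
  then show "\<not> contains_pattern xs [2,3,1]" "\<not> contains_pattern xs [3,1,2]"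
    unfolding contains_pattern_231 contains_pattern_312
    by (meson less_asym)+
  show "contains_pattern xs [3,2,1] \<longleftrightarrow> 3 \<le> length xs"
  proof
    assume "3 \<le> length xs"
    then obtain p q r zs where "xs = p # q # r # zs"
      by (auto simp: numeral_eq_Suc One_nat_def Suc_le_length_iff)
    then have "subseq [p,q,r] xs" "r < q" "q < p"
      using assms by auto
    then show "contains_pattern xs [3,2,1]"
      by (auto simp: contains_pattern_def order_isomorphic_321)
  qed (auto simp: contains_pattern_def order_isomorphic_def dest!: list_emb_length)
  show "contains_pattern xs [4,3,2,1] \<longleftrightarrow> 4 \<le> length xs"
  proof
    assume "4 \<le> length xs"
    then obtain p q r s zs where "xs = p # q # r # s # zs"
      by (auto simp: numeral_eq_Suc One_nat_def Suc_le_length_iff)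
    then have "subseq [p,q,r,s] xs" "s < r" "r < q" "q < p"
      using assms by auto
    then show "contains_pattern xs [4,3,2,1]"
      by (auto simp: contains_pattern_def order_isomorphic_4321)
  qed (auto simp: contains_pattern_def order_isomorphic_def dest!: list_emb_length)
qed

text \<open>Since 21543 is the direct sum of 21 and 321, an occurrence either lies inside
  \<open>ys\<close> or is cut between 1 and 5. A cut after 2 would put 2 below 1, and a later cut
  would put the ascent from 1 to 5 into the decreasing list \<open>xs\<close>.\<close>

lemma contains_21543_append:
  assumes dec: "sorted_wrt (>) xs"
    and below: "\<And>x y. x \<in> set xs \<Longrightarrow> y \<in> set ys \<Longrightarrow> x < y"
  shows "contains_pattern (xs @ ys) [2,1,5,4,3] \<longleftrightarrow>
           contains_pattern ys [2,1,5,4,3] \<or> 2 \<le> length xs \<and> contains_pattern ys [3,2,1]"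
proof
  assume "contains_pattern (xs @ ys) [2,1,5,4,3]"
  then obtain p q r s t where sub: "subseq [p,q,r,s,t] (xs @ ys)"
    and ord: "q < p" "p < t" "t < s" "s < r"
    unfolding contains_pattern_21543 by blast
  then obtain us vs where uv: "[p,q,r,s,t] = us @ vs" "subseq us xs" "subseq vs ys"
    by (auto simp: subseq_append_iff)
  have us: "sorted_wrt (>) us"
    using sorted_wrt_subseq uv(2) dec by blast
  have vs: "\<And>y. y \<in> set vs \<Longrightarrow> y \<in> set ys" and us': "\<And>x. x \<in> set us \<Longrightarrow> x \<in> set xs"
    using subseq_set_subset[OF uv(3)] subseq_set_subset[OF uv(2)] by auto
  consider "us = []" "vs = [p,q,r,s,t]" | "us = [p]" "vs = [q,r,s,t]"
    | "us = [p,q]" "vs = [r,s,t]" | zs where "us = p # q # r # zs"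
    using uv(1) by (auto simp: Cons_eq_append_conv)
  then show "contains_pattern ys [2,1,5,4,3] \<or> 2 \<le> length xs \<and> contains_pattern ys [3,2,1]"
  proof cases
    case 1
    then show ?thesis
      using uv(3) ord unfolding contains_pattern_21543 by blast
  next
    case 2
    then have "p < q" using below us' vs by auto
    then show ?thesis using ord by simp
  next
    case 3
    then show ?thesis
      using uv(3) ord list_emb_length[OF uv(2)] unfolding contains_pattern_321 by auto
  next
    case 4
    then show ?thesis using us ord by auto
  qed
next
  assume "contains_pattern ys [2,1,5,4,3] \<or> 2 \<le> length xs \<and> contains_pattern ys [3,2,1]"
  then show "contains_pattern (xs @ ys) [2,1,5,4,3]"
  proof
    assume "contains_pattern ys [2,1,5,4,3]"
    then show ?thesis
      using contains_pattern_mono subseq_drop_many by blast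
  next
    assume *: "2 \<le> length xs \<and> contains_pattern ys [3,2,1]"
    then obtain p q zs where xs: "xs = [p,q] @ zs"
      by (auto simp: numeral_eq_Suc One_nat_def Suc_le_length_iff)
    obtain r s t where rst: "subseq [r,s,t] ys" "t < s" "s < r"
      using * unfolding contains_pattern_321 by blast
    have "subseq ([p,q] @ [r,s,t]) (xs @ ys)"
      using rst(1) xs by (intro list_emb_append_mono) auto
    moreover have "q < p" "p < t"
      using dec below xs subseq_set_subset[OF rst(1)] by auto
    ultimately show ?thesis
      using rst(2,3) unfolding contains_pattern_21543 append.simps by blast
  qed
qed

section \<open>Layered permutations\<close>

text \<open>The smallest value \<open>a\<close> is a parameter because the layers after the first
  form a layered list starting at \<open>a + c\<close>; inductions therefore let \<open>a\<close>
  vary. A part 0 yields an empty layer, so the encoding is unique only for compositions without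
  0.\<close>

fun layered :: "nat \<Rightarrow> nat list \<Rightarrow> nat list" where
  "layered a [] = []"
| "layered a (c # cs) = rev [a..<a + c] @ layered (a + c) cs"

lemma set_layered: "set (layered a cs) = {a..<a + sum_list cs}"
  by (induction a cs rule: layered.induct) auto

lemma distinct_layered: "distinct (layered a cs)"
  by (induction a cs rule: layered.induct) (auto simp: set_layered)

lemma decreasing_block: "sorted_wrt (>) (rev [a..<b::nat])"
  by (simp add: sorted_wrt_rev)

lemma block_below_layered:
  "x \<in> set (rev [a..<a + c]) \<Longrightarrow> y \<in> set (layered (a + c) cs) \<Longrightarrow> x < y"
  by (auto simp: set_layered)

lemma contains_layered_Cons:
  assumes "\<sigma> \<noteq> []" "last \<sigma> < hd \<sigma>"
  shows "contains_pattern (layered a (c # cs)) \<sigma> \<longleftrightarrow>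
    contains_pattern (rev [a..<a + c]) \<sigma> \<or> contains_pattern (layered (a + c) cs) \<sigma>"
  unfolding layered.simps
  by (rule contains_pattern_append_indecomposable[OF _ assms]) (rule block_below_layered)

lemma not_contains_pattern_Nil: "\<sigma> \<noteq> [] \<Longrightarrow> \<not> contains_pattern [] \<sigma>"
  by (auto simp: contains_pattern_def order_isomorphic_def)

lemma layered_avoids_231: "\<not> contains_pattern (layered a cs) [2,3,1]"
  by (induction a cs rule: layered.induct)
     (simp_all add: not_contains_pattern_Nil contains_layered_Cons
        contains_pattern_decreasing decreasing_block del: layered.simps(2))

lemma layered_avoids_312: "\<not> contains_pattern (layered a cs) [3,1,2]"
  by (induction a cs rule: layered.induct)
     (simp_all add: not_contains_pattern_Nil contains_layered_Cons
        contains_pattern_decreasing decreasing_block del: layered.simps(2))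

lemma layered_contains_321:
  "contains_pattern (layered a cs) [3,2,1] \<longleftrightarrow> (\<exists>c\<in>set cs. 3 \<le> c)"
  by (induction a cs rule: layered.induct)
     (simp_all add: not_contains_pattern_Nil contains_layered_Cons
        contains_pattern_decreasing decreasing_block del: layered.simps(2))

lemma layered_contains_4321:
  "contains_pattern (layered a cs) [4,3,2,1] \<longleftrightarrow> (\<exists>c\<in>set cs. 4 \<le> c)"
  by (induction a cs rule: layered.induct)
     (simp_all add: not_contains_pattern_Nil contains_layered_Cons
        contains_pattern_decreasing decreasing_block del: layered.simps(2))

lemma layered_contains_21543_Cons:
  "contains_pattern (layered a (c # cs)) [2,1,5,4,3] \<longleftrightarrow>
     contains_pattern (layered (a + c) cs) [2,1,5,4,3] \<or> 2 \<le> c \<and> (\<exists>d\<in>set cs. 3 \<le> d)"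
proof -
  have "contains_pattern (rev [a..<a + c] @ layered (a + c) cs) [2,1,5,4,3] \<longleftrightarrow>
      contains_pattern (layered (a + c) cs) [2,1,5,4,3] \<or>
      2 \<le> length (rev [a..<a + c]) \<and> contains_pattern (layered (a + c) cs) [3,2,1]"
    by (rule contains_21543_append[OF decreasing_block]) (rule block_below_layered)
  then show ?thesis by (simp add: layered_contains_321)
qed

section \<open>Compositions whose layered permutations avoid \<open>A1\<close>\<close>

text \<open>These lists consist of 1s only, or of some 1s, then one part 2 or 3, then arbitrary 1s
  and 2s; so 3 occurs at most once. The recursion on the first part is the one by which they are
  counted later.\<close>

fun good_composition :: "nat list \<Rightarrow> bool" where
  "good_composition [] \<longleftrightarrow> True"
| "good_composition (c # cs) \<longleftrightarrow>
     c = 1 \<and> good_composition cs \<or> c \<in> {2, 3} \<and> set cs \<subseteq> {1, 2}"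

lemma good_composition_if_parts_le_2: "set cs \<subseteq> {1, 2} \<Longrightarrow> good_composition cs"
  by (induction cs) auto

lemma good_composition_parts: "good_composition cs \<Longrightarrow> set cs \<subseteq> {1, 2, 3}"
  by (induction cs) auto

text \<open>The pattern 21543 arises exactly when a part of size at least 2 precedes one of size at
  least 3. Zeros are excluded because patterns cannot detect an empty layer, whereas
  \<open>good_composition\<close> rejects it.\<close>

lemma layered_avoids_A1_iff:
  assumes "0 \<notin> set cs"
  shows "(\<forall>\<sigma>\<in>A1. \<not> contains_pattern (layered a cs) \<sigma>) \<longleftrightarrow> good_composition cs"
proof -
  have "(\<forall>c\<in>set cs. c < 4) \<and> \<not> contains_pattern (layered a cs) [2,1,5,4,3] \<longleftrightarrow>
      good_composition cs"
    using assms
  proof (induction a cs rule: layered.induct)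
    case (1 a)
    then show ?case by (simp add: not_contains_pattern_Nil)
  next
    case (2 a c cs)
    have "x \<in> {1, 2} \<longleftrightarrow> x < 3" if "x \<noteq> 0" for x :: nat
      using that by auto
    then have small: "(\<forall>d\<in>set cs. d < 3) \<longleftrightarrow> set cs \<subseteq> {1, 2}"
      using "2.prems" by (metis list.set_intros(2) subset_iff)
    have c: "c < 4 \<longleftrightarrow> c = 1 \<or> c \<in> {2, 3}" "2 \<le> c \<longleftrightarrow> c \<noteq> 1"
      using "2.prems" by auto
    have IH: "(\<forall>d\<in>set cs. d < 4) \<and> \<not> contains_pattern (layered (a + c) cs) [2,1,5,4,3] \<longleftrightarrow>
        good_composition cs"
      using 2 by simp
    have "(\<forall>d\<in>set (c # cs). d < 4) \<and> \<not> contains_pattern (layered a (c # cs)) [2,1,5,4,3] \<longleftrightarrow>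
        c < 4 \<and> good_composition cs \<and> (2 \<le> c \<longrightarrow> (\<forall>d\<in>set cs. d < 3))"
      unfolding layered_contains_21543_Cons IH[symmetric] list.set by (metis insert_iff not_le)
    also have "\<dots> \<longleftrightarrow> good_composition (c # cs)"
      unfolding small c good_composition.simps using good_composition_if_parts_le_2[of cs] by auto
    finally show ?case .
  qed
  then show ?thesis
    by (auto simp: A1_def layered_avoids_231 layered_avoids_312 layered_contains_4321 not_le)
qed

section \<open>Splitting a permutation that avoids 231 and 312 into layers\<close>

text \<open>Used with \<open>m\<close> the first entry of a 231-avoiding permutation and
  \<open>xs\<close> the rest: as soon as an entry exceeds \<open>m\<close>, so do all entries after
  it.\<close>

lemma distinct_split_at_pivot:
  fixes m :: "'a :: linorder"
  assumes "m \<notin> set xs" "\<And>x y. subseq [x, y] xs \<Longrightarrow> \<not> (y < m \<and> m < x)"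
  shows "xs = filter (\<lambda>x. x < m) xs @ filter (\<lambda>x. m < x) xs"
  using assms
proof (induction xs)
  case (Cons x xs)
  have IH: "xs = filter (\<lambda>x. x < m) xs @ filter (\<lambda>x. m < x) xs"
    using Cons.prems by (intro Cons.IH) (simp, blast intro: list_emb_Cons)
  show ?case
  proof (cases "x < m")
    case True
    then show ?thesis using IH by auto
  next
    case False
    then have "m < x" using Cons.prems by auto
    have "m < y" if "y \<in> set xs" for y
      using Cons.prems(2)[of x y] Cons.prems(1) that \<open>m < x\<close>
      by (auto simp: subseq_singleton_left not_less_iff_gr_or_eq)
    then have "filter (\<lambda>x. x < m) xs = []" "filter (\<lambda>x. m < x) xs = xs"
      by (auto simp: filter_empty_conv filter_id_conv dest: less_asym)
    then show ?thesis using \<open>m < x\<close> by auto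
  qed
qed simp

lemma sorted_wrt_if_subseq_pairs:
  assumes "\<And>x y. subseq [x, y] xs \<Longrightarrow> P x y"
  shows "sorted_wrt P xs"
  using assms
proof (induction xs)
  case (Cons x xs)
  have "sorted_wrt P xs"
    using Cons.prems by (intro Cons.IH) (blast intro: list_emb_Cons)
  moreover have "P x y" if "y \<in> set xs" for y
    using Cons.prems[of x y] that by (simp add: subseq_singleton_left)
  ultimately show ?case by simp
qed simp

lemma decreasing_eq_rev_upt:
  assumes "sorted_wrt (>) xs" "set xs = {a..<b::nat}"
  shows "xs = rev [a..<b]"
proof -
  have "sorted_wrt (<) (rev xs)"
    using assms(1) by (simp add: sorted_wrt_rev)
  then have "rev xs = [a..<b]"
    using assms(2) by (intro sorted_distinct_set_unique) (auto simp: strict_sorted_iff)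
  then show ?thesis by (metis rev_rev_ident)
qed

text \<open>Let \<open>m\<close> be the first entry. Avoiding 231 puts all smaller entries before
  all larger ones, and avoiding 312 makes the smaller ones decrease. As the values fill an interval
  from \<open>a\<close>, the entry \<open>m\<close> and the smaller ones form the first layer, and
  the larger ones fill an interval from \<open>Suc m\<close>, so the argument repeats.\<close>

lemma layered_if_avoids:
  assumes "distinct xs" "set xs = {a..<b}"
    and "\<not> contains_pattern xs [2,3,1]" "\<not> contains_pattern xs [3,1,2]"
  shows "\<exists>cs. xs = layered a cs \<and> 0 \<notin> set cs"
  using assms
proof (induction "length xs" arbitrary: xs a rule: less_induct)
  case less
  show ?case
  proof (cases xs)
    case Nil
    then show ?thesis by (intro exI[of _ "[]"]) simp
  next
    case (Cons m ys)
    define lo hi where "lo = filter (\<lambda>x. x < m) ys" and "hi = filter (\<lambda>x. m < x) ys"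
    have m: "a \<le> m" "m < b" "m \<notin> set ys" "distinct ys" and set_ys: "set ys = {a..<b} - {m}"
      using less.prems(1,2) Cons by auto
    have no231: "\<not> (y < m \<and> m < x)" and no312: "\<not> (x < y \<and> y < m)"
      if "subseq [x, y] ys" for x y
    proof -
      have "subseq [m, x, y] xs" using that Cons by simp
      then show "\<not> (y < m \<and> m < x)" "\<not> (x < y \<and> y < m)"
        using less.prems(3,4) unfolding contains_pattern_231 contains_pattern_312
        by blast+
    qed
    have ys: "ys = lo @ hi"
      unfolding lo_def hi_def by (rule distinct_split_at_pivot[OF m(3)]) (rule no231)
    have "distinct lo"
      using m(4) by (simp add: lo_def)
    have "sorted_wrt (>) lo"
    proof (rule sorted_wrt_if_subseq_pairs)
      fix x y assume *: "subseq [x, y] lo"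
      have "subseq lo ys" by (simp add: lo_def)
      with * have "subseq [x, y] ys" by (rule subseq_order.trans)
      moreover have "x \<in> set lo" "y \<in> set lo"
        using subseq_set_subset[OF *] by simp_all
      moreover have "x \<noteq> y"
        using distinct_subseq[OF * \<open>distinct lo\<close>] by simp
      ultimately show "x > y"
        using no312[of x y] by (auto simp: lo_def)
    qed
    have "m # lo = rev [a..<Suc m]"
    proof (intro decreasing_eq_rev_upt)
      show "sorted_wrt (>) (m # lo)"
        using \<open>sorted_wrt (>) lo\<close> by (simp add: lo_def)
      show "set (m # lo) = {a..<Suc m}"
        using m(1,2) by (auto simp: lo_def set_ys)
    qed
    \<comment> \<open>The first layer has length \<open>Suc m - a\<close>, which is positive because
      \<open>a \<le> m\<close>; the interval is rewritten to match the equation for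
      \<open>layered\<close>.\<close>
    then have xs: "xs = rev [a..<a + (Suc m - a)] @ hi"
      using Cons ys m by simp
    have "\<exists>cs. hi = layered (Suc m) cs \<and> 0 \<notin> set cs"
    proof (rule less.hyps)
      show "length hi < length xs"
        by (simp add: Cons ys)
      show "distinct hi"
        using m(4) by (simp add: hi_def)
      show "set hi = {Suc m..<b}"
        unfolding hi_def set_filter set_ys using m(1,2) by auto
      have "contains_pattern hi \<sigma> \<Longrightarrow> contains_pattern xs \<sigma>" for \<sigma>
        unfolding Cons ys by (erule contains_pattern_mono)
          (intro list_emb_Cons subseq_drop_many subseq_order.refl)
      then show "\<not> contains_pattern hi [2,3,1]" "\<not> contains_pattern hi [3,1,2]"
        using less.prems(3,4) by blast+
    qed
    then obtain cs where "hi = layered (Suc m) cs" "0 \<notin> set cs" by blast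
    then have "xs = layered a ((Suc m - a) # cs)" "0 \<notin> set ((Suc m - a) # cs)"
      using xs m by auto
    then show ?thesis by blast
  qed
qed

text \<open>The first entry is the top value \<open>a + c - 1\<close> of the first layer and so
  reveals \<open>c\<close>. Zero parts would leave no trace in the list.\<close>

lemma inj_layered:
  assumes "layered a cs = layered a ds" "0 \<notin> set cs" "0 \<notin> set ds"
  shows "cs = ds"
  using assms
proof (induction cs arbitrary: a ds)
  case Nil
  then show ?case by (cases ds) auto
next
  case (Cons c cs)
  then obtain d ds' where ds: "ds = d # ds'" by (cases ds) auto
  have hd: "hd (layered a (e # es)) = a + e - 1" if "e > 0" for e es
    using that by (cases e) auto
  have "a + c - 1 = a + d - 1"
    using hd[of c cs] hd[of d ds'] Cons.prems ds by (simp del: layered.simps)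
  then have "c = d" using Cons.prems ds by auto
  then show ?case using Cons ds by auto
qed

lemma Av_A1_eq: "Av n A1 = layered 1 ` {cs. good_composition cs \<and> sum_list cs = n}"
proof (intro equalityI subsetI)
  fix \<pi> assume \<pi>: "\<pi> \<in> Av n A1"
  then have d: "distinct \<pi>" "set \<pi> = {1..<Suc n}"
    by (auto simp: Av_def permutations_of_set_def)
  moreover have "\<not> contains_pattern \<pi> [2,3,1]" "\<not> contains_pattern \<pi> [3,1,2]"
    using \<pi> by (auto simp: Av_def A1_def)
  ultimately obtain cs where cs: "\<pi> = layered 1 cs" "0 \<notin> set cs"
    using layered_if_avoids by blast
  have "{1..<1 + sum_list cs} = {1..<Suc n}"
    using d cs set_layered by metis
  then have "sum_list cs = n"
    by (metis card_atLeastLessThan diff_Suc_1 plus_1_eq_Suc)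
  then show "\<pi> \<in> layered 1 ` {cs. good_composition cs \<and> sum_list cs = n}"
    using cs \<pi> layered_avoids_A1_iff by (auto simp: Av_def)
next
  fix \<pi> assume "\<pi> \<in> layered 1 ` {cs. good_composition cs \<and> sum_list cs = n}"
  then obtain cs where cs: "\<pi> = layered 1 cs" "good_composition cs" "sum_list cs = n" by auto
  have "0 \<notin> set cs" using good_composition_parts cs by fastforce
  then have "\<forall>\<sigma>\<in>A1. \<not> contains_pattern \<pi> \<sigma>"
    using cs layered_avoids_A1_iff by blast
  then show "\<pi> \<in> Av n A1"
    using cs by (auto simp: Av_def permutations_of_set_def distinct_layered set_layered)
qed

section \<open>Counting inversions\<close>

lemma finite_inversions: "finite (inversions xs)"
  by (rule finite_subset[of _ "{..<length xs} \<times> {..<length xs}"]) (auto simp: inversions_def)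

lemma inversions_Cons:
  "inversions (x # xs) =
     (\<lambda>j. (0, Suc j)) ` {j. j < length xs \<and> xs ! j < x} \<union> map_prod Suc Suc ` inversions xs"
proof (intro equalityI subsetI)
  fix p assume p: "p \<in> inversions (x # xs)"
  obtain i j where ij: "p = (i, j)" by (cases p)
  show "p \<in> (\<lambda>j. (0, Suc j)) ` {j. j < length xs \<and> xs ! j < x} \<union> map_prod Suc Suc ` inversions xs"
    using p ij by (cases i; cases j) (auto simp: inversions_def map_prod_def image_iff)
qed (auto simp: inversions_def)

lemma card_inversions_Cons:
  "card (inversions (x # xs)) = length (filter (\<lambda>y. y < x) xs) + card (inversions xs)"
proof -
  have "card (inversions (x # xs)) = card ((\<lambda>j. (0::nat, Suc j)) ` {j. j < length xs \<and> xs ! j < x})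
      + card (map_prod Suc Suc ` inversions xs)"
    unfolding inversions_Cons
    by (rule card_Un_disjoint) (auto simp: finite_inversions)
  moreover have "card (map_prod Suc Suc ` inversions xs) = card (inversions xs)"
    by (rule card_image) (auto simp: inj_on_def)
  ultimately show ?thesis
    by (simp add: card_image inj_on_def length_filter_conv_card)
qed

text \<open>Entries of different layers are never inverted, while every pair inside a layer
  is.\<close>

lemma card_inversions_layered:
  "card (inversions (layered a cs)) = (\<Sum>c\<leftarrow>cs. c choose 2)"
proof (induction a cs rule: layered.induct)
  case (1 a)
  then show ?case by (simp add: inversions_def)
next
  case (2 a c cs)
  \<comment> \<open>The first layer is built up from its \<open>d\<close> smallest values, with the
    tail kept fixed at \<open>a + c\<close>. Prepending \<open>a + d\<close> creates exactly
    \<open>d\<close> new inversions, which is the step from \<open>d choose 2\<close> to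
    \<open>Suc d choose 2\<close>.\<close>
  have "card (inversions (rev [a..<a + d] @ layered (a + c) cs)) =
      (d choose 2) + card (inversions (layered (a + c) cs))" if "d \<le> c" for d
    using that
  proof (induction d)
    case (Suc d)
    have "filter (\<lambda>y. y < a + d) (layered (a + c) cs) = []"
      using Suc.prems by (auto simp: filter_empty_conv set_layered)
    moreover have "filter (\<lambda>y. y < a + d) (rev [a..<a + d]) = rev [a..<a + d]"
      by (auto simp: filter_id_conv)
    ultimately show ?case
      using Suc by (simp add: card_inversions_Cons numeral_2_eq_2)
  qed simp
  from this[of c] 2 show ?case by simp
qed

section \<open>Counting compositions\<close>

text \<open>Because \<open>1 choose 2 = 0\<close> and \<open>2 choose 2 = 1\<close>, the index
  \<open>k\<close> is the number of parts 2. These are the lists that may follow a part 2 or 3 in a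
  good composition.\<close>

definition compositions12 :: "nat \<Rightarrow> nat \<Rightarrow> nat list set" where
  "compositions12 n k =
     {cs. set cs \<subseteq> {1, 2} \<and> sum_list cs = n \<and> (\<Sum>c\<leftarrow>cs. c choose 2) = k}"

definition good_compositions :: "nat \<Rightarrow> nat \<Rightarrow> nat list set" where
  "good_compositions n k =
     {cs. good_composition cs \<and> sum_list cs = n \<and> (\<Sum>c\<leftarrow>cs. c choose 2) = k}"

lemma finite_good_compositions: "finite (good_compositions n k)"
proof (rule finite_subset)
  show "finite {cs. set cs \<subseteq> {1, 2, 3::nat} \<and> length cs \<le> n}"
    by (rule finite_lists_length_le) simp
  have "length cs \<le> sum_list cs" if "0 \<notin> set cs" for cs :: "nat list"
    using that by (induction cs) auto
  then show "good_compositions n k \<subseteq> {cs. set cs \<subseteq> {1, 2, 3} \<and> length cs \<le> n}"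
    using good_composition_parts by (fastforce simp: good_compositions_def)
qed

lemma finite_compositions12: "finite (compositions12 n k)"
  by (rule finite_subset[OF _ finite_good_compositions[of n k]])
     (auto simp: compositions12_def good_compositions_def good_composition_if_parts_le_2)

text \<open>The guards keep truncated subtraction from admitting false cases: for
  \<open>n = 0\<close> and \<open>k = 1\<close> the list \<open>[2]\<close> would otherwise count as
  a composition of 1.\<close>

lemma compositions12_rec:
  "compositions12 (Suc n) k = (#) 1 ` compositions12 n k \<union>
     (#) 2 ` (if 1 \<le> n \<and> 1 \<le> k then compositions12 (n - 1) (k - 1) else {})"
  (is "_ = ?R")
proof (intro equalityI subsetI)
  fix cs assume "cs \<in> compositions12 (Suc n) k"
  then show "cs \<in> ?R" by (cases cs) (auto simp: compositions12_def)
qed (auto simp: compositions12_def split: if_splits)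

text \<open>With \<open>k\<close> parts 2 there are \<open>n - k\<close> parts in all, and the 2s
  occupy any \<open>k\<close> of these places. The proof obtains the number from the recurrence by
  Pascal's rule.\<close>

lemma card_compositions12: "card (compositions12 n k) = (n - k) choose k"
proof (induction n arbitrary: k rule: less_induct)
  case (less n)
  show ?case
  proof (cases n)
    case 0
    have "cs \<in> compositions12 0 k \<longleftrightarrow> cs = [] \<and> k = 0" for cs
      by (cases cs) (auto simp: compositions12_def)
    then have "compositions12 0 k = (if k = 0 then {[]} else {})"
      by auto
    then show ?thesis using 0 by (cases k) auto
  next
    case (Suc n')
    have "card (compositions12 n k) = card (compositions12 n' k) +
        (if 1 \<le> n' \<and> 1 \<le> k then card (compositions12 (n' - 1) (k - 1)) else 0)"
      unfolding Suc compositions12_rec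
      by (subst card_Un_disjoint) (auto simp: finite_compositions12 card_image)
    also have "\<dots> = (n' - k choose k) +
        (if 1 \<le> n' \<and> 1 \<le> k then n' - 1 - (k - 1) choose (k - 1) else 0)"
      using less Suc by simp
    also have "\<dots> = (n - k) choose k"
    proof (cases k)
      case (Suc k')
      then show ?thesis
      proof (cases "k \<le> n'")
        case True
        then have "n - k = Suc (n' - k)" "n' - 1 - (k - 1) = n' - k"
          using \<open>n = Suc n'\<close> Suc by auto
        then show ?thesis using True Suc by simp
      \<comment> \<open>For \<open>k > n'\<close> both sides vanish: the upper arguments truncate to
        0, and for \<open>k = 1\<close> the term \<open>0 choose 0\<close> is switched off by the
        guard \<open>1 \<le> n'\<close>.\<close>
      qed (use Suc \<open>n = Suc n'\<close> in \<open>auto simp: not_le\<close>)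
    qed simp
    finally show ?thesis .
  qed
qed

lemma choose_3_2: "3 choose 2 = (3::nat)"
  by (simp add: numeral_eq_Suc One_nat_def)

text \<open>Only a leading 1 leaves a tail of the same kind; after a 2 or a 3 the tail is of the
  kind already counted. A leading 3 accounts for 3 inversions.\<close>

lemma good_compositions_rec:
  "good_compositions (Suc n) k = (#) 1 ` good_compositions n k \<union>
     ((#) 2 ` (if 1 \<le> n \<and> 1 \<le> k then compositions12 (n - 1) (k - 1) else {}) \<union>
      (#) 3 ` (if 2 \<le> n \<and> 3 \<le> k then compositions12 (n - 2) (k - 3) else {}))"
  (is "_ = ?R")
proof (intro equalityI subsetI)
  fix cs assume "cs \<in> good_compositions (Suc n) k"
  then show "cs \<in> ?R"
    by (cases cs) (auto simp: compositions12_def good_compositions_def choose_3_2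
          simp del: sum_list_eq_0_iff)
qed (auto simp: compositions12_def good_compositions_def choose_3_2
      simp del: sum_list_eq_0_iff split: if_splits)

text \<open>The first binomial counts the compositions without a part 3, the second those with one.
  Adding a leading part raises each of them by one application of Pascal's rule.\<close>

lemma card_good_compositions:
  assumes "k \<ge> 3"
  shows "card (good_compositions n k) = (n - k choose k) + (n + 1 - k choose (k - 2))"
proof (induction n)
  case 0
  have "cs \<notin> good_compositions 0 k" for cs
    using assms by (cases cs) (auto simp: good_compositions_def)
  then have "good_compositions 0 k = {}" by blast
  then show ?case using assms by auto
next
  case (Suc n)
  let ?A = "(#) 1 ` good_compositions n k"
  let ?B = "(#) 2 ` (if 1 \<le> n \<and> 1 \<le> k then compositions12 (n - 1) (k - 1) else {})"
  let ?C = "(#) 3 ` (if 2 \<le> n \<and> 3 \<le> k then compositions12 (n - 2) (k - 3) else {})"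
  have "card (good_compositions (Suc n) k) = card ?A + card (?B \<union> ?C)"
    unfolding good_compositions_rec
    by (rule card_Un_disjoint) (auto simp: finite_compositions12 finite_good_compositions)
  also have "card (?B \<union> ?C) = card ?B + card ?C"
    by (rule card_Un_disjoint) (auto simp: finite_compositions12)
  also have "card ?A + (card ?B + card ?C) = card (good_compositions n k) +
      ((if 1 \<le> n \<and> 1 \<le> k then card (compositions12 (n - 1) (k - 1)) else 0) +
       (if 2 \<le> n \<and> 3 \<le> k then card (compositions12 (n - 2) (k - 3)) else 0))"
    by (simp add: card_image)
  also have "\<dots> = (n - k choose k) + (n + 1 - k choose (k - 2)) +
      ((if 1 \<le> n then n - 1 - (k - 1) choose (k - 1) else 0) +
       (if 2 \<le> n then n - 2 - (k - 3) choose (k - 3) else 0))"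
    using Suc assms by (simp add: card_compositions12)
  also have "\<dots> = (Suc n - k choose k) + (Suc n + 1 - k choose (k - 2))"
  proof -
    obtain j where k: "k = j + 3" using assms by (metis add.commute le_Suc_ex)
    \<comment> \<open>For \<open>k \<le> n\<close> all differences are exact and Pascal's rule
      applies twice. At \<open>n + 1 = k\<close> the last term on the left is
      \<open>0 choose (k - 3)\<close>, which is 1 just for \<open>k = 3\<close> and agrees with
      \<open>1 choose (k - 2)\<close> on the right. For smaller \<open>n\<close> everything
      vanishes, with the guard \<open>2 \<le> n\<close> taking care of \<open>k = 3\<close>.\<close>
    consider "n + 1 < k" | "n + 1 = k" | "k \<le> n" by linarith
    then show ?thesis
    proof cases
      case 3
      define m where "m = n - k"
      then have n: "n = m + (j + 3)" using 3 k by simp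
      have j3: "j + 3 = Suc (Suc (Suc j))" by simp
      show ?thesis by (simp add: n k j3 One_nat_def)
    qed (auto simp: k numeral_eq_Suc One_nat_def)
  qed
  finally show ?case .
qed

section \<open>The two closed forms\<close>

text \<open>This is the hockey-stick identity after the shift \<open>l = m + (k - 3)\<close>, where
  \<open>m\<close> runs from 0 to \<open>n - k\<close>.\<close>

lemma sum_ibinom:
  assumes "k \<ge> 3"
  shows "(\<Sum>l = int k - 3..int n - 3. ibinom (l - (int k - 3)) (int k - 3)) =
    ibinom (int n - int k + 1) (int k - 2)"
proof (cases "k \<le> n")
  case True
  have k2: "int k - 2 = int (k - 2)" "int k - 3 = int (k - 3)" using assms by auto
  have ib: "ibinom (int a) (int b) = a choose b" for a b
    by (auto simp: ibinom_def)
  have "(\<Sum>l = int k - 3..int n - 3. ibinom (l - (int k - 3)) (int k - 3)) =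
      (\<Sum>m\<le>n - k. ibinom (int m) (int k - 3))"
    by (rule sum.reindex_bij_witness[of _ "\<lambda>m. int m + (int k - 3)" "\<lambda>l. nat (l - (int k - 3))"])
       (use True assms in auto)
  also have "\<dots> = (\<Sum>m\<le>n - k. m choose (k - 3))"
    by (simp add: k2 ib)
  also have "\<dots> = Suc (n - k) choose Suc (k - 3)"
    by (rule sum_choose_upper)
  also have "\<dots> = ibinom (int (Suc (n - k))) (int (k - 2))"
    using assms unfolding ib by (intro arg_cong2[of _ _ _ _ binomial]) auto
  also have "int (Suc (n - k)) = int n - int k + 1" using True by simp
  finally show ?thesis by (simp only: k2)
next
  \<comment> \<open>Here the range of \<open>l\<close> is empty, and on the right the upper argument
    is at most 0 while \<open>k - 2\<close> is positive.\<close>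
  case False
  then show ?thesis using assms by (auto simp: ibinom_def)
qed

theorem theorem3p2:
  fixes n k :: nat
  assumes "n \<ge> 1" and "k \<ge> 3"
  shows "card {\<pi> \<in> Av n A1. card (inversions \<pi>) = k} =
           ibinom (int n - int k) (int k) +
           (\<Sum>l = int k - 3..int n - 3. ibinom (l - (int k - 3)) (int k - 3))
         \<and>
         ibinom (int n - int k) (int k) +
           (\<Sum>l = int k - 3..int n - 3. ibinom (l - (int k - 3)) (int k - 3)) =
         ibinom (int n - int k) (int k) + ibinom (int n - int k + 1) (int k - 2)"
proof -
  have "{\<pi> \<in> Av n A1. card (inversions \<pi>) = k} = layered 1 ` good_compositions n k"
    by (auto simp: Av_A1_eq good_compositions_def card_inversions_layered)
  moreover have "inj_on (layered 1) (good_compositions n k)"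
  proof (rule inj_onI)
    fix cs ds assume "cs \<in> good_compositions n k" "ds \<in> good_compositions n k"
      and eq: "layered 1 cs = layered 1 ds"
    then have "0 \<notin> set cs" "0 \<notin> set ds"
      using good_composition_parts by (fastforce simp: good_compositions_def)+
    with eq show "cs = ds" by (rule inj_layered)
  qed
  ultimately have "card {\<pi> \<in> Av n A1. card (inversions \<pi>) = k} =
      (n - k choose k) + (n + 1 - k choose (k - 2))"
    using card_good_compositions[OF assms(2)] by (simp add: card_image)
  \<comment> \<open>For \<open>n < k\<close> the natural difference truncates to 0, and
    \<open>0 choose k\<close> is 0 because \<open>k\<close> is positive, in agreement with the
    convention of \<open>ibinom\<close>. The next binomial is treated in the same way, with
    \<open>k - 2\<close> positive.\<close>
  also have "(n - k choose k) = ibinom (int n - int k) (int k)"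
    using assms by (auto simp: ibinom_def nat_diff_distrib binomial_eq_0)
  also have "(n + 1 - k choose (k - 2)) = ibinom (int n - int k + 1) (int k - 2)"
  proof -
    have "nat (int n - int k + 1) = n + 1 - k" "nat (int k - 2) = k - 2"
      using assms by auto
    then show ?thesis
      using assms by (auto simp: ibinom_def binomial_eq_0)
  qed
  finally show ?thesis
    using sum_ibinom[OF assms(2), of n] by simp
qed

end
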